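(* Let $D=(V,E)$ be a (possibly infinite) digraph and let $k$ be a positive integer. Then $D$ can be generated by at most $k$ derangements if and only if (i) $\deg^+_D(x)\le k$ and $\deg^-_D(x)\le k$ for each $x\in V$; and (ii) $k\bigl(|N^+_D(T)|-|T|\bigr)\ \ge\ \sum_{x\in N^+_D(T)}\deg^-_D(x)-\sum_{x\in T}\deg^+_D(x)$ for each finite subset $T$ of $V$; and (iii) $k\bigl(|N^-_D(T)|-|T|\bigr)\ \ge\ \sum_{x\in N^-_D(T)}\deg^+_D(x)-\sum_{x\in T}\deg^-_D(x)$ for each finite subset $T$ of $V$.
   Context: A digraph $D=(V,E)$ consists of a (possibly infinite) vertex set $V$ and an arc set $E\subseteq\{(x,y):x,y\in V,\ x\ne y\}$ (so digraphs are simple and loopless). A derangement of $V$ is a bijection $\sigma:V\to V$ with $x^\sigma\ne x$ for all $x\in V$. A set $\mathcal{S}$ of derangements of $V$ generates $D$ if $E=\{(x,x^\sigma):x\in V,\ \sigma\in\mathcal{S}\}$. For $x\in V$, $N^+_D(x)=\{y:(x,y)\in E\}$, $N^-_D(x)=\{y:(y,x)\in E\}$, $\deg^+_D(x)=|N^+_D(x)|$, $\deg^-_D(x)=|N^-_D(x)|$; for $S\subseteq V$, $N^+_D(S)=\bigcup_{x\in S}N^+_D(x)$ and $N^-_D(S)=\bigcup_{x\in S}N^-_D(x)$.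
   Formalization: "At most k derangements" is taken to mean at least one and at most k; with zero derangements allowed, the arcless digraph on a nonempty vertex set would be generated but violates (ii) for a one-element T. *)

theory Defs
  imports "Graph_Theory.Pair_Digraph" "HOL-Combinatorics.Permutations"
begin

lemma pair_loopfree_digraph_iff:
  "pair_loopfree_digraph D \<longleftrightarrow>
     parcs D \<subseteq> {(x, y). x \<in> pverts D \<and> y \<in> pverts D \<and> x \<noteq> y}"
  unfolding pair_loopfree_digraph_def pair_loopfree_digraph_axioms_def pair_wf_digraph_def
  by fastforce

definition derangement_of :: "'a set \<Rightarrow> ('a \<Rightarrow> 'a) \<Rightarrow> bool" where
  "derangement_of V \<sigma> \<longleftrightarrow> \<sigma> permutes V \<and> (\<forall>x\<in>V. \<sigma> x \<noteq> x)"

definition generates :: "('a \<Rightarrow> 'a) set \<Rightarrow> 'a pair_pre_digraph \<Rightarrow> bool" where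
  "generates S D \<longleftrightarrow>
     (\<forall>\<sigma>\<in>S. derangement_of (pverts D) \<sigma>) \<and>
     parcs D = {(x, \<sigma> x) | x \<sigma>. x \<in> pverts D \<and> \<sigma> \<in> S}"

text \<open>
  The generating set must be nonempty: with no derangements at all one would generate the
  digraph without arcs, which (on a nonempty vertex set) violates the counting conditions
  that characterise generation by at most \<open>k\<close> derangements.
\<close>
definition generated_by_at_most :: "nat \<Rightarrow> 'a pair_pre_digraph \<Rightarrow> bool" where
  "generated_by_at_most k D \<longleftrightarrow>
     (\<exists>S. S \<noteq> {} \<and> finite S \<and> card S \<le> k \<and> generates S D)"

definition out_nbrs :: "'a pair_pre_digraph \<Rightarrow> 'a \<Rightarrow> 'a set" where
  "out_nbrs D x = {y. (x, y) \<in> parcs D}"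

definition in_nbrs :: "'a pair_pre_digraph \<Rightarrow> 'a \<Rightarrow> 'a set" where
  "in_nbrs D x = {y. (y, x) \<in> parcs D}"

definition out_nbrs_set :: "'a pair_pre_digraph \<Rightarrow> 'a set \<Rightarrow> 'a set" where
  "out_nbrs_set D S = (\<Union>x\<in>S. out_nbrs D x)"

definition in_nbrs_set :: "'a pair_pre_digraph \<Rightarrow> 'a set \<Rightarrow> 'a set" where
  "in_nbrs_set D S = (\<Union>x\<in>S. in_nbrs D x)"

text \<open>
  These are 0 for an infinite neighbourhood, so a bound on a degree has to be accompanied by
  finiteness of the neighbourhood.
\<close>
definition deg_out :: "'a pair_pre_digraph \<Rightarrow> 'a \<Rightarrow> nat" where
  "deg_out D x = card (out_nbrs D x)"

definition deg_in :: "'a pair_pre_digraph \<Rightarrow> 'a \<Rightarrow> nat" where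
  "deg_in D x = card (in_nbrs D x)"

end

theory Submission
  imports Defs
begin

text \<open>
  Give every arc a multiplicity at least 1 such that all out- and in-multiplicities are \<open>k\<close>.
  The excess multiplicities form a transportation problem with supplies \<open>k - deg\<^sup>+\<close> and demands
  \<open>k - deg\<^sup>-\<close> along the arcs, for which (ii) and (iii) are Hall's conditions; it is solved by a
  perfect matching between copies of the vertices. The resulting \<open>k\<close>-regular bipartite
  multigraph splits into \<open>k\<close> perfect matchings, which are the derangements.
  Conversely, each of the derangements contributes exactly \<open>|N\<^sup>+(T)| - |T|\<close> arcs that enter
  \<open>N\<^sup>+(T)\<close> from outside \<open>T\<close>, and together they cover all such arcs.
\<close>

section \<open>Infinite perfect matchings\<close>

text \<open>
  Rado's proof: in a minimal subrelation satisfying Hall's condition every image is a singleton,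
  by submodularity of the cardinality of images.
\<close>
theorem marriage_infinite:
  fixes R :: "('a \<times> 'b) set"
  assumes fin: "\<And>i. i \<in> I \<Longrightarrow> finite (R `` {i})"
    and hall: "\<And>J. J \<subseteq> I \<Longrightarrow> finite J \<Longrightarrow> card J \<le> card (R `` J)"
  shows "\<exists>f. inj_on f I \<and> (\<forall>i\<in>I. (i, f i) \<in> R)"
proof -
  have finJ: "finite (R `` J)" if "J \<subseteq> I" "finite J" for J
  proof -
    have "R `` J = (\<Union>i\<in>J. R `` {i})" by blast
    then show ?thesis using that fin by auto
  qed
  \<comment> \<open>\<open>C\<close> collects the sets of pairs that can be deleted from
    \<open>R\<close> without violating Hall's condition. Working with deleted sets turns a minimal
    subrelation into a maximal element, so Zorn's lemma applies with unions as upper bounds.\<close>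
  define C where "C = {M. \<forall>J. J \<subseteq> I \<longrightarrow> finite J \<longrightarrow> card J \<le> card ((R - M) `` J)}"
  have "{} \<in> C" using hall by (simp add: C_def)
  have chain: "\<Union>\<M> \<in> C" if \<M>: "\<M> \<noteq> {}" "subset.chain C \<M>" for \<M>
    unfolding C_def
  proof (intro CollectI allI impI)
    fix J assume J: "J \<subseteq> I" "finite J"
    \<comment> \<open>Only finitely many pairs of \<open>R\<close> start in the finite set
      \<open>J\<close>, so those deleted by the whole chain are already deleted by a single member
      of it.\<close>
    have "finite (\<Union>\<M> \<inter> (R \<inter> J \<times> UNIV))"
      by (rule finite_subset[of _ "J \<times> R `` J"]) (use J finJ in auto)
    then obtain M where M: "M \<in> \<M>" "\<Union>\<M> \<inter> (R \<inter> J \<times> UNIV) \<subseteq> M"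
      using finite_subset_Union_chain[of "\<Union>\<M> \<inter> (R \<inter> J \<times> UNIV)" \<M> C] \<M> by auto
    have "(R - \<Union>\<M>) `` J = (R - M) `` J" using M by blast
    moreover have "M \<in> C" using M \<M> by (auto simp: subset.chain_def)
    ultimately show "card J \<le> card ((R - \<Union>\<M>) `` J)" using J by (simp add: C_def)
  qed
  obtain M where M: "M \<in> C" and max: "\<And>X. X \<in> C \<Longrightarrow> M \<subseteq> X \<Longrightarrow> X = M"
    using subset_Zorn_nonempty[of C] \<open>{} \<in> C\<close> chain by blast
  define Q where "Q = R - M"
  have hallQ: "card J \<le> card (Q `` J)" if "J \<subseteq> I" "finite J" for J
    using M that by (simp add: C_def Q_def)
  have finQ: "finite (Q `` J)" if "J \<subseteq> I" "finite J" for J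
    by (rule finite_subset[OF _ finJ[OF that]]) (auto simp: Q_def)
  have critical: "\<exists>J. J \<subseteq> I \<and> finite J \<and> i \<in> J \<and> card ((Q - {(i, x)}) `` J) < card J"
    if "(i, x) \<in> Q" for i x
  proof -
    have "insert (i, x) M \<notin> C" using max[of "insert (i, x) M"] that by (auto simp: Q_def)
    moreover have "R - insert (i, x) M = Q - {(i, x)}" by (auto simp: Q_def)
    ultimately obtain J where J: "J \<subseteq> I" "finite J" "\<not> card J \<le> card ((Q - {(i, x)}) `` J)"
      by (auto simp: C_def)
    moreover have "i \<in> J"
    proof (rule ccontr)
      assume "i \<notin> J"
      then have "(Q - {(i, x)}) `` J = Q `` J" by blast
      then show False using J hallQ by simp
    qed
    ultimately show ?thesis by auto
  qed
  have unique: "x = y" if "i \<in> I" "(i, x) \<in> Q" "(i, y) \<in> Q" for i x y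
  proof (rule ccontr)
    assume "x \<noteq> y"
    obtain J where J: "J \<subseteq> I" "finite J" "i \<in> J" "card ((Q - {(i, x)}) `` J) < card J"
      using critical \<open>(i, x) \<in> Q\<close> by blast
    obtain K where K: "K \<subseteq> I" "finite K" "i \<in> K" "card ((Q - {(i, y)}) `` K) < card K"
      using critical \<open>(i, y) \<in> Q\<close> by blast
    let ?A = "(Q - {(i, x)}) `` J" and ?B = "(Q - {(i, y)}) `` K"
    have fA: "finite ?A" by (rule finite_subset[OF _ finQ[OF J(1,2)]]) auto
    have fB: "finite ?B" by (rule finite_subset[OF _ finQ[OF K(1,2)]]) auto
    have "card (J \<union> K) \<le> card (Q `` (J \<union> K))" using J K by (intro hallQ) auto
    \<comment> \<open>Nothing is lost in the union: \<open>x\<close> is still reached from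
      \<open>i\<close> through \<open>?B\<close>, and \<open>y\<close> through
      \<open>?A\<close>.\<close>
    also have "Q `` (J \<union> K) = ?A \<union> ?B" using \<open>x \<noteq> y\<close> J(3) K(3) that by blast
    finally have un: "card (J \<union> K) \<le> card (?A \<union> ?B)" .
    \<comment> \<open>The index \<open>i\<close> is left out because its image is incomplete in both
      \<open>?A\<close> and \<open>?B\<close>. This costs 1, whereas criticality of \<open>J\<close>
      and \<open>K\<close> gains 1 each, so the two counts contradict each other.\<close>
    have "card (J \<inter> K - {i}) \<le> card (Q `` (J \<inter> K - {i}))" using J K by (intro hallQ) auto
    also have "\<dots> \<le> card (?A \<inter> ?B)" using fA by (intro card_mono) auto
    finally have inter: "card (J \<inter> K - {i}) \<le> card (?A \<inter> ?B)" .
    have "card (J \<inter> K) = Suc (card (J \<inter> K - {i}))"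
      using J K by (intro card.remove) auto
    then show False
      using un inter J(4) K(4) card_Un_Int[OF J(2) K(2)] card_Un_Int[OF fA fB] by linarith
  qed
  have "\<exists>y. (i, y) \<in> Q" if "i \<in> I" for i
  proof -
    have "card {i} \<le> card (Q `` {i})" using that by (intro hallQ) auto
    then have "Q `` {i} \<noteq> {}" by (intro notI) simp
    then show ?thesis by blast
  qed
  then obtain f where f: "\<And>i. i \<in> I \<Longrightarrow> (i, f i) \<in> Q" by metis
  have "inj_on f I"
  proof (rule inj_onI, rule ccontr)
    fix i j assume ij: "i \<in> I" "j \<in> I" "f i = f j" "i \<noteq> j"
    have "Q `` {i, j} = {f i}" using ij f unique by auto
    then show False using hallQ[of "{i, j}"] ij by simp
  qed
  then show ?thesis using f by (auto simp: Q_def)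
qed

text \<open>The second conjunct makes the bijection usable for matchings: if \<open>f\<close> runs
  along a relation and \<open>g\<close> along its converse, then \<open>h\<close> stays inside the
  relation.\<close>

lemma Schroeder_Bernstein_matching:
  assumes f: "inj_on f X" "f ` X \<subseteq> Y" and g: "inj_on g Y" "g ` Y \<subseteq> X"
  shows "\<exists>h. bij_betw h X Y \<and> (\<forall>x\<in>X. h x = f x \<or> g (h x) = x)"
proof -
  define Z where "Z = lfp (\<lambda>S. X - g ` (Y - f ` S))"
  have "mono (\<lambda>S. X - g ` (Y - f ` S))" by (rule monoI) blast
  then have Z: "Z = X - g ` (Y - f ` Z)" unfolding Z_def by (rule lfp_unfold)
  define h where "h = (\<lambda>x. if x \<in> Z then f x else inv_into Y g x)"
  have ZX: "Z \<subseteq> X" using Z by blast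
  have XZ: "X - Z = g ` (Y - f ` Z)" using Z g by blast
  have "bij_betw f Z (f ` Z)" using f(1) ZX by (auto simp: bij_betw_def intro: inj_on_subset)
  then have "bij_betw h Z (f ` Z)" by (rule bij_betw_cong[THEN iffD1, rotated]) (simp add: h_def)
  moreover have "bij_betw h (X - Z) (Y - f ` Z)"
  proof (rule bij_betw_imageI)
    show "inj_on h (X - Z)"
    proof (rule inj_on_inverseI[of _ g])
      fix x assume "x \<in> X - Z"
      then have "x \<in> g ` Y" "h x = inv_into Y g x" using XZ by (auto simp: h_def)
      then show "g (h x) = x" by (simp add: f_inv_into_f)
    qed
    show "h ` (X - Z) = Y - f ` Z"
    proof -
      have "h (g y) = y" if "y \<in> Y - f ` Z" for y
      proof -
        have "g y \<notin> Z" using that XZ by blast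
        then show ?thesis using that g(1) by (simp add: h_def)
      qed
      then show ?thesis unfolding XZ by (force simp: image_image)
    qed
  qed
  ultimately have "bij_betw h (Z \<union> (X - Z)) (f ` Z \<union> (Y - f ` Z))"
    by (rule bij_betw_combine) auto
  moreover have "Z \<union> (X - Z) = X" "f ` Z \<union> (Y - f ` Z) = Y" using ZX f by auto
  moreover have "\<forall>x\<in>X. h x = f x \<or> g (h x) = x"
  proof
    fix x assume "x \<in> X"
    show "h x = f x \<or> g (h x) = x"
    proof (cases "x \<in> Z")
      case False
      then have "x \<in> g ` Y" using \<open>x \<in> X\<close> XZ by blast
      then show ?thesis using False by (simp add: h_def f_inv_into_f)
    qed (simp add: h_def)
  qed
  ultimately show ?thesis by metis
qed

text \<open>Hall's condition on one side yields only an injection, which may miss points when the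
  sets are infinite. The injections from both sides are merged by the Schroeder-Bernstein
  construction.\<close>

theorem perfect_matching_infinite:
  fixes R :: "('a \<times> 'b) set"
  assumes R: "R \<subseteq> X \<times> Y"
    and fin: "\<And>x. x \<in> X \<Longrightarrow> finite (R `` {x})" "\<And>y. y \<in> Y \<Longrightarrow> finite (R\<inverse> `` {y})"
    and hall: "\<And>T. T \<subseteq> X \<Longrightarrow> finite T \<Longrightarrow> card T \<le> card (R `` T)"
      "\<And>T. T \<subseteq> Y \<Longrightarrow> finite T \<Longrightarrow> card T \<le> card (R\<inverse> `` T)"
  shows "\<exists>h. bij_betw h X Y \<and> (\<forall>x\<in>X. (x, h x) \<in> R)"
proof -
  obtain f where f: "inj_on f X" "\<forall>x\<in>X. (x, f x) \<in> R"
    using marriage_infinite[of X R] fin(1) hall(1) by blast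
  obtain g where g: "inj_on g Y" "\<forall>y\<in>Y. (y, g y) \<in> R\<inverse>"
    using marriage_infinite[of Y "R\<inverse>"] fin(2) hall(2) by blast
  obtain h where h: "bij_betw h X Y" "\<forall>x\<in>X. h x = f x \<or> g (h x) = x"
    using Schroeder_Bernstein_matching[of f X Y g] f g R by blast
  have "(x, h x) \<in> R" if "x \<in> X" for x
    using h that f g by (metis bij_betwE converse_iff)
  then show ?thesis using h by blast
qed

section \<open>Transportation problems and regular multigraphs\<close>

lemma hall_copies:
  fixes R :: "('a \<times> 'b) set" and a :: "'a \<Rightarrow> nat" and b :: "'b \<Rightarrow> nat"
  assumes fin: "\<And>x. x \<in> X \<Longrightarrow> finite (R `` {x})"
    and hall: "\<And>T. T \<subseteq> X \<Longrightarrow> finite T \<Longrightarrow> sum a T \<le> sum b (R `` T)"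
    and J: "J \<subseteq> Sigma X (\<lambda>x. {..<a x})" "finite J"
    and Q: "Q = {((x, i), (y, j)). (x, y) \<in> R \<and> i < a x \<and> j < b y}"
  shows "card J \<le> card (Q `` J)"
proof -
  let ?T = "fst ` J"
  have T: "?T \<subseteq> X" "finite ?T" using J by auto
  have finT: "finite (R `` ?T)"
  proof (rule finite_subset)
    show "R `` ?T \<subseteq> (\<Union>x\<in>?T. R `` {x})" by blast
    show "finite (\<Union>x\<in>?T. R `` {x})" using T(1) by (intro finite_UN_I[OF T(2)] fin) auto
  qed
  have "card J \<le> card (Sigma ?T (\<lambda>x. {..<a x}))"
  proof (rule card_mono)
    show "finite (Sigma ?T (\<lambda>x. {..<a x}))" using T by blast
    show "J \<subseteq> Sigma ?T (\<lambda>x. {..<a x})"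
    proof
      fix p assume "p \<in> J"
      then show "p \<in> Sigma ?T (\<lambda>x. {..<a x})" using J(1) by (cases p) force
    qed
  qed
  also have "\<dots> = sum a ?T" using T by simp
  also have "\<dots> \<le> sum b (R `` ?T)" by (rule hall[OF T])
  also have "\<dots> = card (Sigma (R `` ?T) (\<lambda>y. {..<b y}))" using finT by simp
  also have "Sigma (R `` ?T) (\<lambda>y. {..<b y}) = Q `` J"
  proof (intro equalityI subsetI)
    fix q assume "q \<in> Sigma (R `` ?T) (\<lambda>y. {..<b y})"
    then obtain x i where xi: "(x, i) \<in> J" "(x, fst q) \<in> R" "snd q < b (fst q)" by force
    moreover from xi(1) have "i < a x" using J(1) by blast
    ultimately have "((x, i), q) \<in> Q" by (auto simp: Q case_prod_unfold)
    then show "q \<in> Q `` J" using xi(1) by blast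
  next
    fix q assume "q \<in> Q `` J"
    then show "q \<in> Sigma (R `` ?T) (\<lambda>y. {..<b y})" by (force simp: Q)
  qed
  finally show ?thesis .
qed

text \<open>Replace each \<open>x\<close> by \<open>a x\<close> copies and each \<open>y\<close> by
  \<open>b y\<close> copies, match the copies perfectly, and let \<open>f x y\<close> count the
  copies of \<open>x\<close> matched to copies of \<open>y\<close>.\<close>

lemma transportation:
  fixes R :: "('a \<times> 'b) set" and a :: "'a \<Rightarrow> nat" and b :: "'b \<Rightarrow> nat"
  assumes R: "R \<subseteq> X \<times> Y"
    and fin: "\<And>x. x \<in> X \<Longrightarrow> finite (R `` {x})" "\<And>y. y \<in> Y \<Longrightarrow> finite (R\<inverse> `` {y})"
    and hall: "\<And>T. T \<subseteq> X \<Longrightarrow> finite T \<Longrightarrow> sum a T \<le> sum b (R `` T)"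
      "\<And>T. T \<subseteq> Y \<Longrightarrow> finite T \<Longrightarrow> sum b T \<le> sum a (R\<inverse> `` T)"
  shows "\<exists>f. (\<forall>x\<in>X. (\<Sum>y\<in>R `` {x}. f x y) = a x) \<and> (\<forall>y\<in>Y. (\<Sum>x\<in>R\<inverse> `` {y}. f x y) = b y)"
proof -
  define Q where "Q = {((x, i), (y, j)). (x, y) \<in> R \<and> i < a x \<and> j < b y}"
  have Qc: "Q\<inverse> = {((y, j), (x, i)). (y, x) \<in> R\<inverse> \<and> j < b y \<and> i < a x}" by (auto simp: Q_def)
  let ?X = "Sigma X (\<lambda>x. {..<a x})" and ?Y = "Sigma Y (\<lambda>y. {..<b y})"
  have "\<exists>h. bij_betw h ?X ?Y \<and> (\<forall>p\<in>?X. (p, h p) \<in> Q)"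
  proof (rule perfect_matching_infinite)
    show "Q \<subseteq> ?X \<times> ?Y" using R by (auto simp: Q_def)
    show "finite (Q `` {p})" if "p \<in> ?X" for p
      by (rule finite_subset[of _ "Sigma (R `` {fst p}) (\<lambda>y. {..<b y})"])
        (use that fin in \<open>auto simp: Q_def\<close>)
    show "finite (Q\<inverse> `` {p})" if "p \<in> ?Y" for p
      by (rule finite_subset[of _ "Sigma (R\<inverse> `` {fst p}) (\<lambda>x. {..<a x})"])
        (use that fin in \<open>auto simp: Q_def\<close>)
    show "card J \<le> card (Q `` J)" if "J \<subseteq> ?X" "finite J" for J
      by (rule hall_copies[OF fin(1) hall(1) that Q_def])
    show "card J \<le> card (Q\<inverse> `` J)" if "J \<subseteq> ?Y" "finite J" for J
      by (rule hall_copies[OF fin(2) hall(2) that Qc])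
  qed
  then obtain h where h: "bij_betw h ?X ?Y" "\<forall>p\<in>?X. (p, h p) \<in> Q" by blast
  have hR: "(x, fst (h (x, i))) \<in> R" if "x \<in> X" "i < a x" for x i
  proof -
    have "((x, i), h (x, i)) \<in> Q" using h(2) that by blast
    then show ?thesis by (auto simp: Q_def)
  qed
  define f where "f x y = card {i. i < a x \<and> fst (h (x, i)) = y}" for x y
  have "(\<Sum>y\<in>R `` {x}. f x y) = a x" if x: "x \<in> X" for x
  proof -
    have "(\<Sum>y\<in>R `` {x}. f x y) = card (\<Union>y\<in>R `` {x}. {i. i < a x \<and> fst (h (x, i)) = y})"
      unfolding f_def using fin x by (intro card_UN_disjoint[symmetric]) auto
    also have "(\<Union>y\<in>R `` {x}. {i. i < a x \<and> fst (h (x, i)) = y}) = {..<a x}"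
      using hR x by auto
    finally show ?thesis by simp
  qed
  moreover have "(\<Sum>x\<in>R\<inverse> `` {y}. f x y) = b y" if y: "y \<in> Y" for y
  proof -
    \<comment> \<open>\<open>?F\<close> holds all copies matched to copies of \<open>y\<close>.
      Transporting it through the injection \<open>h\<close> turns it into the set of all
      \<open>b y\<close> copies of \<open>y\<close>.\<close>
    let ?F = "Sigma (R\<inverse> `` {y}) (\<lambda>x. {i. i < a x \<and> fst (h (x, i)) = y})"
    have "(\<Sum>x\<in>R\<inverse> `` {y}. f x y) = card ?F" using fin y by (simp add: f_def)
    also have "\<dots> = card (h ` ?F)"
    proof (rule card_image[symmetric])
      have "?F \<subseteq> ?X" using R by auto
      then show "inj_on h ?F" using bij_betw_imp_inj_on[OF h(1)] inj_on_subset by blast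
    qed
    also have "h ` ?F = {y} \<times> {..<b y}"
    proof
      show "h ` ?F \<subseteq> {y} \<times> {..<b y}"
      proof
        fix q assume "q \<in> h ` ?F"
        then obtain x i where xi: "(x, y) \<in> R" "i < a x" "fst (h (x, i)) = y" "q = h (x, i)" by auto
        then have "q \<in> ?Y" using h(1) R by (auto dest!: bij_betwE)
        then show "q \<in> {y} \<times> {..<b y}" using xi by auto
      qed
      show "{y} \<times> {..<b y} \<subseteq> h ` ?F"
      proof
        fix q assume q: "q \<in> {y} \<times> {..<b y}"
        then have "q \<in> h ` ?X" using h(1) y by (auto simp: bij_betw_def)
        then obtain x i where xi: "x \<in> X" "i < a x" "q = h (x, i)" by auto
        moreover have "fst (h (x, i)) = y" using xi q by auto
        ultimately show "q \<in> h ` ?F" using hR[of x i] by auto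
      qed
    qed
    finally show ?thesis by simp
  qed
  ultimately show ?thesis by blast
qed

text \<open>Double counting: the arcs leaving \<open>T\<close> carry total multiplicity
  \<open>k * card T\<close>. Those of positive multiplicity all end in \<open>Q\<close>
  T\<open>, where the incoming arcs carry\<close>k * card (Q \<open>T)\<close> in total.\<close>

lemma hall_regular:
  fixes R :: "('a \<times> 'b) set" and m :: "'a \<Rightarrow> 'b \<Rightarrow> nat"
  assumes R: "R \<subseteq> X \<times> Y" and k: "k > 0"
    and fin: "\<And>x. x \<in> X \<Longrightarrow> finite (R `` {x})" "\<And>y. y \<in> Y \<Longrightarrow> finite (R\<inverse> `` {y})"
    and sums: "\<And>x. x \<in> X \<Longrightarrow> (\<Sum>y\<in>R `` {x}. m x y) = k"
      "\<And>y. y \<in> Y \<Longrightarrow> (\<Sum>x\<in>R\<inverse> `` {y}. m x y) = k"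
    and T: "T \<subseteq> X" "finite T"
    and Q: "Q = {(x, y). (x, y) \<in> R \<and> m x y > 0}"
  shows "card T \<le> card (Q `` T)"
proof -
  have "Q `` T \<subseteq> (\<Union>x\<in>T. R `` {x})" by (auto simp: Q)
  then have finQT: "finite (Q `` T)" by (rule finite_subset) (use T fin in auto)
  have QT: "Q `` T \<subseteq> Y" using R by (auto simp: Q)
  have "k * card T = (\<Sum>x\<in>T. \<Sum>y\<in>R `` {x}. m x y)" using T sums(1) by (simp add: subset_iff)
  also have "\<dots> = (\<Sum>(x, y)\<in>Sigma T (\<lambda>x. R `` {x}). m x y)"
    using T fin by (intro sum.Sigma) auto
  also have "\<dots> = (\<Sum>(x, y)\<in>Sigma T (\<lambda>x. Q `` {x}). m x y)"
    using T fin by (intro sum.mono_neutral_right) (auto simp: Q)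
  also have "\<dots> = (\<Sum>(y, x)\<in>prod.swap ` Sigma T (\<lambda>x. Q `` {x}). m x y)"
    by (subst sum.reindex) (auto simp: case_prod_unfold)
  also have "\<dots> \<le> (\<Sum>(y, x)\<in>Sigma (Q `` T) (\<lambda>y. R\<inverse> `` {y}). m x y)"
    using finQT QT fin(2) by (intro sum_mono2) (auto simp: Q)
  also have "\<dots> = (\<Sum>y\<in>Q `` T. \<Sum>x\<in>R\<inverse> `` {y}. m x y)"
    using finQT QT fin(2) by (intro sum.Sigma[symmetric]) auto
  also have "\<dots> = k * card (Q `` T)" using QT sums(2) by (simp add: subset_iff)
  finally show ?thesis using k by simp
qed

text \<open>Induction on \<open>k\<close>: the arcs of positive multiplicity contain a perfect
  matching, and subtracting it leaves a \<open>k\<close>-regular multigraph on the same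
  \<open>R\<close>. The same permutation may be split off repeatedly, hence only
  \<open>card S \<le> k\<close>.\<close>

lemma regular_decomposition:
  fixes R :: "('a \<times> 'a) set" and m :: "'a \<Rightarrow> 'a \<Rightarrow> nat"
  assumes R: "R \<subseteq> V \<times> V"
    and fin: "\<And>x. x \<in> V \<Longrightarrow> finite (R `` {x})" "\<And>y. y \<in> V \<Longrightarrow> finite (R\<inverse> `` {y})"
    and sums: "\<And>x. x \<in> V \<Longrightarrow> (\<Sum>y\<in>R `` {x}. m x y) = k"
      "\<And>y. y \<in> V \<Longrightarrow> (\<Sum>x\<in>R\<inverse> `` {y}. m x y) = k"
  shows "\<exists>S. finite S \<and> card S \<le> k \<and> (k > 0 \<longrightarrow> S \<noteq> {}) \<and> (\<forall>\<sigma>\<in>S. \<sigma> permutes V) \<and>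
    {(x, y). (x, y) \<in> R \<and> m x y > 0} = {(x, \<sigma> x) |x \<sigma>. x \<in> V \<and> \<sigma> \<in> S}"
  using sums
proof (induction k arbitrary: m)
  case 0
  have "m x y = 0" if "(x, y) \<in> R" for x y
    using that R fin(1)[of x] 0(1)[of x] by auto
  then show ?case by (intro exI[of _ "{}"]) auto
next
  case (Suc k)
  define Q where "Q = {(x, y). (x, y) \<in> R \<and> m x y > 0}"
  have Qc: "Q\<inverse> = {(y, x). (y, x) \<in> R\<inverse> \<and> m x y > 0}" by (auto simp: Q_def)
  have "\<exists>h. bij_betw h V V \<and> (\<forall>x\<in>V. (x, h x) \<in> Q)"
  proof (rule perfect_matching_infinite)
    show "Q \<subseteq> V \<times> V" using R by (auto simp: Q_def)
    show "finite (Q `` {x})" if "x \<in> V" for x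
      by (rule finite_subset[OF _ fin(1)[OF that]]) (auto simp: Q_def)
    show "finite (Q\<inverse> `` {x})" if "x \<in> V" for x
      by (rule finite_subset[OF _ fin(2)[OF that]]) (auto simp: Q_def)
    show "card T \<le> card (Q `` T)" if "T \<subseteq> V" "finite T" for T
      by (rule hall_regular[OF R _ fin Suc.prems that Q_def]) auto
    show "card T \<le> card (Q\<inverse> `` T)" if "T \<subseteq> V" "finite T" for T
      by (rule hall_regular[where R = "R\<inverse>" and X = V and Y = V and m = "\<lambda>y x. m x y" and k = "Suc k"])
        (use R fin Suc.prems that Qc in auto)
  qed
  then obtain h where h: "bij_betw h V V" "\<And>x. x \<in> V \<Longrightarrow> (x, h x) \<in> Q" by blast
  \<comment> \<open>\<open>permutes\<close> demands the identity outside \<open>V\<close>, where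
    \<open>h\<close> is unspecified.\<close>
  define \<sigma> where "\<sigma> x = (if x \<in> V then h x else x)" for x
  have \<sigma>: "\<sigma> permutes V"
  proof (rule bij_imp_permutes)
    show "bij_betw \<sigma> V V" using h(1) by (rule bij_betw_cong[THEN iffD1, rotated]) (simp add: \<sigma>_def)
  qed (simp add: \<sigma>_def)
  have \<sigma>Q: "(x, \<sigma> x) \<in> Q" if "x \<in> V" for x using h that by (simp add: \<sigma>_def)
  \<comment> \<open>The truncated subtraction is exact on \<open>R\<close>, since
    \<open>\<sigma>\<close> uses only arcs of positive multiplicity.\<close>
  define m' where "m' x y = m x y - of_bool (\<sigma> x = y)" for x y
  have m: "m x y = m' x y + of_bool (\<sigma> x = y)" if "(x, y) \<in> R" for x y
  proof -
    have "x \<in> V" using that R by auto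
    then show ?thesis using \<sigma>Q[of x] by (auto simp: m'_def Q_def)
  qed
  have "(\<Sum>y\<in>R `` {x}. m' x y) = k" if x: "x \<in> V" for x
  proof -
    have "Suc k = (\<Sum>y\<in>R `` {x}. m' x y + of_bool (\<sigma> x = y))"
      using Suc.prems(1)[OF x] m by (metis (no_types, lifting) Image_singleton_iff sum.cong)
    also have "\<dots> = (\<Sum>y\<in>R `` {x}. m' x y) + (\<Sum>y\<in>R `` {x}. if \<sigma> x = y then 1 else 0)"
      by (simp add: sum.distrib of_bool_def)
    also have "(\<Sum>y\<in>R `` {x}. if \<sigma> x = y then 1 else 0::nat) = 1"
      using \<sigma>Q[OF x] fin(1)[OF x] by (simp add: Q_def)
    finally show ?thesis by simp
  qed
  moreover have "(\<Sum>x\<in>R\<inverse> `` {y}. m' x y) = k" if y: "y \<in> V" for y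
  proof -
    have "Suc k = (\<Sum>x\<in>R\<inverse> `` {y}. m' x y + of_bool (\<sigma> x = y))"
      using Suc.prems(2)[OF y] m by (metis (no_types, lifting) Image_singleton_iff converse_iff sum.cong)
    \<comment> \<open>The only arc of \<open>\<sigma>\<close> into \<open>y\<close> starts at
      \<open>inv \<sigma> y\<close>; in this form the indicator sum collapses.\<close>
    also have "\<dots> = (\<Sum>x\<in>R\<inverse> `` {y}. m' x y) + (\<Sum>x\<in>R\<inverse> `` {y}. if inv \<sigma> y = x then 1 else 0)"
      using permutes_inverses[OF \<sigma>] unfolding sum.distrib of_bool_def
      by (intro arg_cong2[where f = plus] sum.cong refl) metis
    also have "(\<Sum>x\<in>R\<inverse> `` {y}. if inv \<sigma> y = x then 1 else 0::nat) = 1"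
      using \<sigma>Q[of "inv \<sigma> y"] fin(2)[OF y] permutes_inverses[OF \<sigma>] permutes_in_image[OF permutes_inv[OF \<sigma>]] y
      by (simp add: Q_def)
    finally show ?thesis by simp
  qed
  ultimately obtain S where S: "finite S" "card S \<le> k" "\<forall>\<sigma>\<in>S. \<sigma> permutes V"
    "{(x, y). (x, y) \<in> R \<and> m' x y > 0} = {(x, \<sigma> x) |x \<sigma>. x \<in> V \<and> \<sigma> \<in> S}"
    using Suc.IH[of m'] by auto
  have "{(x, y). (x, y) \<in> R \<and> m x y > 0}
      = {(x, y). (x, y) \<in> R \<and> m' x y > 0} \<union> {(x, \<sigma> x) |x. x \<in> V}"
    using m \<sigma>Q R by (fastforce simp: Q_def)
  also have "\<dots> = {(x, \<tau> x) |x \<tau>. x \<in> V \<and> \<tau> \<in> insert \<sigma> S}" unfolding S(4) by blast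
  finally show ?case using S \<sigma> by (intro exI[of _ "insert \<sigma> S"]) (auto simp: card_insert_if)
qed

section \<open>Generation by permutations\<close>

text \<open>The left-hand side counts the arcs entering \<open>E\<close>
  T\<open>from outside\<close>T\<open>. For each\<close>\<sigma>\<open>in\<close>S\<open>the set\<close>\<sigma>
  \<open>T\<close> lies in \<open>E\<close>
  T\<open>and has as many elements as\<close>T\<open>, so\<close>\<sigma>\<open>supplies exactly\<close>card
  (E \<open>T) - card T\<close> such arcs.\<close>

lemma permutations_image_bound:
  assumes S: "finite S" "S \<noteq> {}" "card S \<le> k" and perm: "\<And>\<sigma>. \<sigma> \<in> S \<Longrightarrow> \<sigma> permutes V"
    and E: "E = {(x, \<sigma> x) |x \<sigma>. x \<in> V \<and> \<sigma> \<in> S}"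
    and T: "finite T" "T \<subseteq> V"
  shows "(\<Sum>y\<in>E `` T. int (card (E\<inverse> `` {y}))) - (\<Sum>x\<in>T. int (card (E `` {x})))
    \<le> int k * (int (card (E `` T)) - int (card T))"
proof -
  let ?N = "E `` T"
  have "?N \<subseteq> (\<lambda>(\<sigma>, x). \<sigma> x) ` (S \<times> T)" by (auto simp: E)
  then have finN: "finite ?N" by (rule finite_subset) (use S T in simp)
  have NV: "?N \<subseteq> V" using perm by (auto simp: E permutes_in_image)
  have finin: "finite (E\<inverse> `` {y})" for y
  proof (rule finite_subset)
    show "E\<inverse> `` {y} \<subseteq> (\<lambda>\<sigma>. inv \<sigma> y) ` S"
    proof
      fix x assume "x \<in> E\<inverse> `` {y}"
      then obtain \<sigma> where \<sigma>: "\<sigma> \<in> S" "y = \<sigma> x" by (auto simp: E)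
      then have "x = inv \<sigma> y" using perm permutes_inverses(2) by metis
      then show "x \<in> (\<lambda>\<sigma>. inv \<sigma> y) ` S" using \<sigma>(1) by blast
    qed
  qed (use S in simp)
  have finout: "finite (E `` {x})" for x
    by (rule finite_subset[of _ "(\<lambda>\<sigma>. \<sigma> x) ` S"]) (auto simp: E S)
  \<comment> \<open>Both arc sets are written as (head, tail), so that the arcs \<open>?O\<close>
    leaving \<open>T\<close> form a subset of the arcs \<open>?I\<close> entering
    \<open>?N\<close>.\<close>
  let ?I = "Sigma ?N (\<lambda>y. E\<inverse> `` {y})" and ?O = "prod.swap ` Sigma T (\<lambda>x. E `` {x})"
  have count: "card {y \<in> ?N. inv \<sigma> y \<notin> T} = card ?N - card T" "card T \<le> card ?N"
    if "\<sigma> \<in> S" for \<sigma>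
  proof -
    have sub: "\<sigma> ` T \<subseteq> ?N" using that T by (auto simp: E)
    have card: "card (\<sigma> ` T) = card T"
      using perm[OF that] by (intro card_image) (metis inj_on_subset permutes_inj subset_UNIV)
    have "{y \<in> ?N. inv \<sigma> y \<notin> T} = ?N - \<sigma> ` T"
      using permutes_inverses[OF perm[OF that]] by (auto intro: rev_image_eqI)
    then show "card {y \<in> ?N. inv \<sigma> y \<notin> T} = card ?N - card T"
      using sub card T by (simp add: card_Diff_subset)
    show "card T \<le> card ?N" using card_mono[OF finN sub] card by simp
  qed
  \<comment> \<open>Any member of \<open>S\<close> gives this. It makes the natural subtraction
    below exact when it is read over the integers.\<close>
  have le: "card T \<le> card ?N" using S(2) count(2) by blast
  have "(\<Sum>y\<in>?N. int (card (E\<inverse> `` {y}))) = int (card ?I)"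
    using finN finin by simp
  moreover have "(\<Sum>x\<in>T. int (card (E `` {x}))) = int (card ?O)"
    using T finout by (subst card_image) auto
  moreover have "card ?I = card ?O + card (?I - ?O)"
  proof -
    have "?O \<subseteq> ?I" by auto
    moreover have "finite ?I" using finN finin by blast
    ultimately show ?thesis by (metis card_Diff_subset card_mono finite_subset le_add_diff_inverse)
  qed
  moreover have "card (?I - ?O) \<le> k * (card ?N - card T)"
  proof -
    \<comment> \<open>For a fixed permutation an arc is determined by its head. An arc shared by
      several permutations is counted more than once, hence only an upper bound.\<close>
    have "?I - ?O \<subseteq> (\<Union>\<sigma>\<in>S. (\<lambda>y. (y, inv \<sigma> y)) ` {y \<in> ?N. inv \<sigma> y \<notin> T})"
    proof (rule subsetI)
      fix p assume p: "p \<in> ?I - ?O"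
      then obtain y z where yz: "p = (y, z)" "y \<in> ?N" "(z, y) \<in> E" "z \<notin> T" by force
      then obtain \<sigma> where \<sigma>: "\<sigma> \<in> S" "y = \<sigma> z" by (auto simp: E)
      have "inv \<sigma> y = z" using \<sigma> permutes_inverses(2)[OF perm[OF \<sigma>(1)]] by simp
      then show "p \<in> (\<Union>\<sigma>\<in>S. (\<lambda>y. (y, inv \<sigma> y)) ` {y \<in> ?N. inv \<sigma> y \<notin> T})"
        using yz by (intro UN_I[OF \<sigma>(1)] image_eqI[of _ _ y]) auto
    qed
    then have "card (?I - ?O) \<le> card (\<Union>\<sigma>\<in>S. (\<lambda>y. (y, inv \<sigma> y)) ` {y \<in> ?N. inv \<sigma> y \<notin> T})"
      using S(1) finN by (intro card_mono) auto
    also have "\<dots> \<le> (\<Sum>\<sigma>\<in>S. card ((\<lambda>y. (y, inv \<sigma> y)) ` {y \<in> ?N. inv \<sigma> y \<notin> T}))"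
      by (rule card_UN_le[OF S(1)])
    also have "\<dots> \<le> (\<Sum>\<sigma>\<in>S. card ?N - card T)"
    proof (rule sum_mono)
      fix \<sigma> assume "\<sigma> \<in> S"
      then show "card ((\<lambda>y. (y, inv \<sigma> y)) ` {y \<in> ?N. inv \<sigma> y \<notin> T}) \<le> card ?N - card T"
        using card_image_le[of "{y \<in> ?N. inv \<sigma> y \<notin> T}" "\<lambda>y. (y, inv \<sigma> y)"] finN count(1) by simp
    qed
    also have "\<dots> \<le> k * (card ?N - card T)" using S(3) by simp
    finally show ?thesis .
  qed
  then have "int (card (?I - ?O)) \<le> int k * (int (card ?N) - int (card T))"
    using le by (metis of_nat_diff of_nat_le_iff of_nat_mult)
  ultimately show ?thesis by linarith
qed

lemma permutations_arcs_converse: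
  assumes "\<And>\<sigma>. \<sigma> \<in> S \<Longrightarrow> \<sigma> permutes V"
  shows "{(x, \<sigma> x) |x \<sigma>. x \<in> V \<and> \<sigma> \<in> S}\<inverse> = {(x, \<sigma> x) |x \<sigma>. x \<in> V \<and> \<sigma> \<in> inv ` S}"
proof (intro equalityI subrelI)
  fix y x assume "(y, x) \<in> {(x, \<sigma> x) |x \<sigma>. x \<in> V \<and> \<sigma> \<in> S}\<inverse>"
  then obtain \<sigma> where \<sigma>: "x \<in> V" "\<sigma> \<in> S" "y = \<sigma> x" by blast
  then have "y \<in> V" "x = inv \<sigma> y"
    using assms[OF \<sigma>(2)] by (simp_all add: permutes_in_image permutes_inverses)
  then show "(y, x) \<in> {(x, \<sigma> x) |x \<sigma>. x \<in> V \<and> \<sigma> \<in> inv ` S}" using \<sigma>(2) by blast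
next
  fix y x assume "(y, x) \<in> {(x, \<sigma> x) |x \<sigma>. x \<in> V \<and> \<sigma> \<in> inv ` S}"
  then obtain \<sigma> where \<sigma>: "y \<in> V" "\<sigma> \<in> S" "x = inv \<sigma> y" by blast
  then have "x \<in> V" "y = \<sigma> x"
    using assms[OF \<sigma>(2)] by (simp_all add: permutes_in_image permutes_inv permutes_inverses)
  then show "(y, x) \<in> {(x, \<sigma> x) |x \<sigma>. x \<in> V \<and> \<sigma> \<in> S}\<inverse>" using \<sigma>(2) by blast
qed

lemma permutations_image_finite:
  assumes S: "finite S" "card S \<le> k" and E: "E = {(x, \<sigma> x) |x \<sigma>. x \<in> V \<and> \<sigma> \<in> S}"
  shows "finite (E `` {x}) \<and> card (E `` {x}) \<le> k"
proof -
  have sub: "E `` {x} \<subseteq> (\<lambda>\<sigma>. \<sigma> x) ` S" by (auto simp: E)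
  then have "card (E `` {x}) \<le> card S"
    using S(1) by (meson card_image_le card_mono finite_imageI le_trans)
  then show ?thesis using sub S finite_subset by fastforce
qed

text \<open>The degree bounds make \<open>k - a x\<close> and \<open>k - b y\<close> exact, so the
  counting condition rearranges into Hall's condition for these deficiencies.\<close>

lemma int_hall_iff:
  assumes "\<And>x. x \<in> T \<Longrightarrow> a x \<le> k" "\<And>y. y \<in> N \<Longrightarrow> b y \<le> (k::nat)"
  shows "(\<Sum>y\<in>N. int (b y)) - (\<Sum>x\<in>T. int (a x)) \<le> int k * (int (card N) - int (card T))
    \<longleftrightarrow> (\<Sum>x\<in>T. k - a x) \<le> (\<Sum>y\<in>N. k - b y)"
proof -
  have "int (\<Sum>x\<in>T. k - a x) = int k * int (card T) - (\<Sum>x\<in>T. int (a x))"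
    using assms(1) by (simp add: of_nat_diff sum_subtractf)
  moreover have "int (\<Sum>y\<in>N. k - b y) = int k * int (card N) - (\<Sum>y\<in>N. int (b y))"
    using assms(2) by (simp add: of_nat_diff sum_subtractf)
  ultimately show ?thesis
    by (subst of_nat_le_iff[where 'a = int, symmetric]) (simp only: algebra_simps, linarith)
qed

lemma permutations_generate_iff:
  fixes E :: "('a \<times> 'a) set"
  assumes E: "E \<subseteq> V \<times> V" and k: "k > 0"
  shows "(\<exists>S. S \<noteq> {} \<and> finite S \<and> card S \<le> k \<and> (\<forall>\<sigma>\<in>S. \<sigma> permutes V) \<and>
      E = {(x, \<sigma> x) |x \<sigma>. x \<in> V \<and> \<sigma> \<in> S}) \<longleftrightarrow>
    (\<forall>x\<in>V. finite (E `` {x}) \<and> card (E `` {x}) \<le> k \<and>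
      finite (E\<inverse> `` {x}) \<and> card (E\<inverse> `` {x}) \<le> k) \<and>
    (\<forall>T. finite T \<and> T \<subseteq> V \<longrightarrow> int k * (int (card (E `` T)) - int (card T)) \<ge>
      (\<Sum>x\<in>E `` T. int (card (E\<inverse> `` {x}))) - (\<Sum>x\<in>T. int (card (E `` {x})))) \<and>
    (\<forall>T. finite T \<and> T \<subseteq> V \<longrightarrow> int k * (int (card (E\<inverse> `` T)) - int (card T)) \<ge>
      (\<Sum>x\<in>E\<inverse> `` T. int (card (E `` {x}))) - (\<Sum>x\<in>T. int (card (E\<inverse> `` {x}))))"
    (is "?L \<longleftrightarrow> ?deg \<and> ?out \<and> ?in")
proof
  assume ?L
  then obtain S where S: "S \<noteq> {}" "finite S" "card S \<le> k" "\<And>\<sigma>. \<sigma> \<in> S \<Longrightarrow> \<sigma> permutes V"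
    "E = {(x, \<sigma> x) |x \<sigma>. x \<in> V \<and> \<sigma> \<in> S}" by blast
  have Sc: "finite (inv ` S)" "inv ` S \<noteq> {}" "card (inv ` S) \<le> k"
    "\<And>\<sigma>. \<sigma> \<in> inv ` S \<Longrightarrow> \<sigma> permutes V"
    using S card_image_le[OF S(2), of inv] by (auto intro: permutes_inv)
  have Ec: "E\<inverse> = {(x, \<sigma> x) |x \<sigma>. x \<in> V \<and> \<sigma> \<in> inv ` S}"
    unfolding S(5) using S(4) by (rule permutations_arcs_converse)
  show "?deg \<and> ?out \<and> ?in"
    using permutations_image_finite[OF S(2,3,5)] permutations_image_finite[OF Sc(1,3) Ec]
      permutations_image_bound[OF S(2,1,3,4,5)] permutations_image_bound[OF Sc Ec]
    by simp
next
  assume R: "?deg \<and> ?out \<and> ?in"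
  then have fin: "\<And>x. x \<in> V \<Longrightarrow> finite (E `` {x})" "\<And>x. x \<in> V \<Longrightarrow> finite (E\<inverse> `` {x})"
    and deg: "\<And>x. x \<in> V \<Longrightarrow> card (E `` {x}) \<le> k" "\<And>x. x \<in> V \<Longrightarrow> card (E\<inverse> `` {x}) \<le> k"
    by auto
  \<comment> \<open>The out- and in-multiplicity still missing at \<open>x\<close> once every arc
    has been taken once.\<close>
  define a where "a x = k - card (E `` {x})" for x
  define b where "b x = k - card (E\<inverse> `` {x})" for x
  have "sum a T \<le> sum b (E `` T)" if T: "T \<subseteq> V" "finite T" for T
  proof -
    have "E `` T \<subseteq> V" using E by blast
    then show ?thesis unfolding a_def b_def
      using R T deg by (subst int_hall_iff[symmetric]) (auto simp: subset_iff)
  qed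
  moreover have "sum b T \<le> sum a (E\<inverse> `` T)" if T: "T \<subseteq> V" "finite T" for T
  proof -
    have "E\<inverse> `` T \<subseteq> V" using E by blast
    then show ?thesis unfolding a_def b_def
      using R T deg by (subst int_hall_iff[symmetric]) (auto simp: subset_iff)
  qed
  ultimately obtain f where f: "\<And>x. x \<in> V \<Longrightarrow> (\<Sum>y\<in>E `` {x}. f x y) = a x"
    "\<And>y. y \<in> V \<Longrightarrow> (\<Sum>x\<in>E\<inverse> `` {y}. f x y) = b y"
    using transportation[OF E fin, of a b] by blast
  \<comment> \<open>The successor is the one obligatory copy of each arc. It makes every
    multiplicity positive, so the permutations obtained cover all of \<open>E\<close>.\<close>
  have "\<And>x. x \<in> V \<Longrightarrow> (\<Sum>y\<in>E `` {x}. Suc (f x y)) = k"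
    "\<And>y. y \<in> V \<Longrightarrow> (\<Sum>x\<in>E\<inverse> `` {y}. Suc (f x y)) = k"
    using f deg unfolding a_def b_def by (simp_all add: sum_Suc)
  from regular_decomposition[OF E fin this] show ?L using k by auto
qed

theorem theorem1p1:
  fixes D :: "'a pair_pre_digraph" and k :: nat
  assumes "pair_loopfree_digraph D" and "k > 0"
  shows "generated_by_at_most k D \<longleftrightarrow>
    (\<forall>x\<in>pverts D. finite (out_nbrs D x) \<and> deg_out D x \<le> k \<and>
                   finite (in_nbrs D x) \<and> deg_in D x \<le> k) \<and>
    (\<forall>T. finite T \<and> T \<subseteq> pverts D \<longrightarrow>
       int k * (int (card (out_nbrs_set D T)) - int (card T)) \<ge>
         (\<Sum>x\<in>out_nbrs_set D T. int (deg_in D x)) - (\<Sum>x\<in>T. int (deg_out D x))) \<and>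
    (\<forall>T. finite T \<and> T \<subseteq> pverts D \<longrightarrow>
       int k * (int (card (in_nbrs_set D T)) - int (card T)) \<ge>
         (\<Sum>x\<in>in_nbrs_set D T. int (deg_out D x)) - (\<Sum>x\<in>T. int (deg_in D x)))"
proof -
  let ?V = "pverts D" and ?E = "parcs D"
  have E: "?E \<subseteq> ?V \<times> ?V" and loopfree: "\<And>x. (x, x) \<notin> ?E"
    using assms(1) by (auto simp: pair_loopfree_digraph_iff)
  have nbrs: "out_nbrs D x = ?E `` {x}" "in_nbrs D x = ?E\<inverse> `` {x}" for x
    by (auto simp: out_nbrs_def in_nbrs_def)
  have nbrs_set: "out_nbrs_set D T = ?E `` T" "in_nbrs_set D T = ?E\<inverse> `` T" for T
    by (auto simp: out_nbrs_set_def in_nbrs_set_def nbrs)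
  \<comment> \<open>A fixed point of a generating permutation would be a loop of \<open>D\<close>,
    so for generating sets derangements and permutations coincide.\<close>
  have "(\<forall>\<sigma>\<in>S. derangement_of ?V \<sigma>) \<longleftrightarrow> (\<forall>\<sigma>\<in>S. \<sigma> permutes ?V)"
    if "?E = {(x, \<sigma> x) |x \<sigma>. x \<in> ?V \<and> \<sigma> \<in> S}" for S
  proof -
    have "\<sigma> x \<noteq> x" if "\<sigma> \<in> S" "x \<in> ?V" for \<sigma> x
    proof
      assume "\<sigma> x = x"
      then have "(x, x) \<in> {(x, \<sigma> x) |x \<sigma>. x \<in> ?V \<and> \<sigma> \<in> S}" using that by (smt (verit) CollectI)
      then show False
        using loopfree \<open>?E = {(x, \<sigma> x) |x \<sigma>. x \<in> ?V \<and> \<sigma> \<in> S}\<close> by metis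
    qed
    then show ?thesis by (auto simp: derangement_of_def)
  qed
  then have "generates S D \<longleftrightarrow>
      (\<forall>\<sigma>\<in>S. \<sigma> permutes ?V) \<and> ?E = {(x, \<sigma> x) |x \<sigma>. x \<in> ?V \<and> \<sigma> \<in> S}" for S
    unfolding generates_def by (rule rev_conj_cong[OF refl])
  then have "generated_by_at_most k D \<longleftrightarrow>
      (\<exists>S. S \<noteq> {} \<and> finite S \<and> card S \<le> k \<and> (\<forall>\<sigma>\<in>S. \<sigma> permutes ?V) \<and>
        ?E = {(x, \<sigma> x) |x \<sigma>. x \<in> ?V \<and> \<sigma> \<in> S})"
    unfolding generated_by_at_most_def by simp
  then show ?thesis
    unfolding permutations_generate_iff[OF E assms(2)] nbrs_set deg_out_def deg_in_def nbrs .
qed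

end
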